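(* Let $n_1,n_2\geq 1$ and let $T=\{(x_1,\dots,x_{n_1},y_1,\dots,y_{n_2})\in\mathbb{R}^{n_1+n_2}: x_i>0,\ y_j>0 \text{ for all } 1\le i\le n_1,\ 1\le j\le n_2\}$. Then the (deterministic) communication complexity of recognizing $T$, as well as that of recognizing its euclidean closure $\overline T$, is at least $n_1+n_2$.
   Context: Coordinates are $(X,Y)=(X_1,\dots,X_{n_1},Y_1,\dots,Y_{n_2})$. A (real) communication protocol is a finite rooted tree. To each non-leaf vertex $v$ is attached either a polynomial $a_v(X)\in\mathbb{R}[X]$ (computed by the first party) or $b_v(Y)\in\mathbb{R}[Y]$ (computed by the second party). If $q_1,\dots,q_r$ are the polynomials attached to the vertices on the path from the root to $v$ (including $v$), then $v$ carries finitely many testing polynomials $P_{v,1},\dots,P_{v,N_v}\in\mathbb{R}[Q_1,\dots,Q_r]$, and on input $(x,y)$ the computation branches at $v$ according to the signs ($<0,=0,>0$) of $P_{v,j}(q_1(x,y),\dots,q_r(x,y))$. Leaves are labelled "accept" or "reject"; a protocol recognizes a set if it accepts exactly the inputs in it. The communication complexity of a protocol is its depth, and that of a set is the minimal depth of a protocol recognizing it. *)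

theory Defs
  imports
    "HOL-Analysis.Analysis"
    "HOL-Library.Poly_Mapping"
    "HOL-Library.Extended_Nat"
begin

(* Real multivariate polynomials in variables indexed by 'v: a monomial is a finitely
   supported exponent vector, a polynomial a finitely supported coefficient function. *)

type_synonym 'v rpoly = "('v \<Rightarrow>\<^sub>0 nat) \<Rightarrow>\<^sub>0 real"

definition poly_eval :: "'v rpoly \<Rightarrow> ('v \<Rightarrow> real) \<Rightarrow> real" where
  "poly_eval p f =
     (\<Sum>m\<in>Poly_Mapping.keys p. Poly_Mapping.lookup p m *
        (\<Prod>i\<in>Poly_Mapping.keys m. f i ^ Poly_Mapping.lookup m i))"

definition poly_vars :: "'v rpoly \<Rightarrow> 'v set" where
  "poly_vars p = (\<Union>m\<in>Poly_Mapping.keys p. Poly_Mapping.keys m)"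

(* The coordinates X and Y are indexed by the finite types 'm and 'n, so the numbers of
   coordinates are CARD('m) and CARD('n), and the ambient space is the product of
   real ^ 'm and real ^ 'n. *)

type_synonym ('m, 'n) input = "(real ^ 'm) \<times> (real ^ 'n)"

datatype ('m, 'n) message = First "'m rpoly" | Second "'n rpoly"

fun message_value :: "('m::finite, 'n::finite) message \<Rightarrow> ('m, 'n) input \<Rightarrow> real" where
  "message_value (First a) z = poly_eval a (\<lambda>i. fst z $ i)"
| "message_value (Second b) z = poly_eval b (\<lambda>j. snd z $ j)"

(* Leaf True accepts, Leaf False rejects. Vertex q Ps branch cs is a non-leaf vertex with
   attached polynomial q, testing polynomials Ps and list of children cs; the computation
   proceeds to the child whose position is branch s, where s is the list of signs of the
   testing polynomials. Variable i of a testing polynomial stands for the polynomial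
   attached to the vertex at distance i from the root. *)

datatype ('m, 'n) protocol =
  Leaf bool
| Vertex "('m, 'n) message" "nat rpoly list" "real list \<Rightarrow> nat" "('m, 'n) protocol list"

(* The argument r is the number of proper ancestors, so r + 1 polynomials are available to
   the testing polynomials of the vertex. The second conjunct assigns a child to each of
   the possible sign vectors; in particular a non-leaf vertex has children. *)

fun well_formed :: "nat \<Rightarrow> ('m::finite, 'n::finite) protocol \<Rightarrow> bool" where
  "well_formed r (Leaf b) \<longleftrightarrow> True"
| "well_formed r (Vertex q Ps branch cs) \<longleftrightarrow>
     (\<forall>P\<in>set Ps. poly_vars P \<subseteq> {..r}) \<and>
     (\<forall>s. length s = length Ps \<and> set s \<subseteq> {-1, 0, 1} \<longrightarrow> branch s < length cs) \<and>
     (\<forall>c\<in>set cs. well_formed (Suc r) c)"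

(* The list vs holds the values on z of the polynomials attached to the proper ancestors,
   the root first. *)

fun accepts :: "real list \<Rightarrow> ('m::finite, 'n::finite) protocol \<Rightarrow> ('m, 'n) input \<Rightarrow> bool" where
  "accepts vs (Leaf b) z = b"
| "accepts vs (Vertex q Ps branch cs) z =
     (let ws = vs @ [message_value q z];
          s = map (\<lambda>P. sgn (poly_eval P (\<lambda>i. ws ! i))) Ps
      in map (\<lambda>c. accepts ws c z) cs ! branch s)"

(* Number of edges on a longest path from the root to a leaf. *)

fun depth :: "('m::finite, 'n::finite) protocol \<Rightarrow> nat" where
  "depth (Leaf b) = 0"
| "depth (Vertex q Ps branch cs) = Suc (Max (insert 0 (depth ` set cs)))"

definition recognizes :: "('m::finite, 'n::finite) protocol \<Rightarrow> ('m, 'n) input set \<Rightarrow> bool" where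
  "recognizes p S \<longleftrightarrow> (\<forall>z. accepts [] p z \<longleftrightarrow> z \<in> S)"

(* Infima in enat are attained on nonempty sets; the value is infinite exactly if no
   protocol recognizes S. *)

definition comm_complexity :: "('m::finite, 'n::finite) input set \<Rightarrow> enat" where
  "comm_complexity S = (INF p \<in> {p. well_formed 0 p \<and> recognizes p S}. enat (depth p))"

end

theory Submission
  imports Defs "HOL-Library.Function_Algebras"
begin

text \<open>
  Label the \<open>n\<close> coordinates by distinct primes \<open>p\<^sub>u\<close> and consider the points with coordinates
  \<open>\<plusminus>p\<^sub>u\<^bsup>-k\<^esup>\<close>, negative exactly for \<open>u \<in> S\<close>. There every polynomial becomes a finite sum of terms
  \<open>c\<^sub>j \<chi>\<^sub>S(j) j\<^bsup>-k\<^esup>\<close>, where \<open>\<chi>\<^sub>S\<close> is the completely multiplicative sign with \<open>\<chi>\<^sub>S(p\<^sub>u) = -1\<close> iff \<open>u \<in> S\<close>,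
  and for large \<open>k\<close> its sign is that of the term with the least index \<open>j\<close>. The leading indices of
  the algebra generated by \<open>r\<close> polynomials contain at most \<open>r\<close> numbers that are multiplicatively
  independent modulo squares, since products of powers of the corresponding functions have distinct
  leading indices and are thus linearly independent. If \<open>r < n\<close>, some nonempty \<open>S\<close> therefore has
  \<open>\<chi>\<^sub>S = 1\<close> on all leading indices, and no test along the path of the positive point (\<open>S\<close> empty)
  distinguishes it from the point with the coordinates in \<open>S\<close> negated.
\<close>

section \<open>Spaces of real functions\<close>

interpretation rfun: vector_space "\<lambda>(c::real) (f::'x \<Rightarrow> real) x. c * f x"
  by unfold_locales (auto simp: fun_eq_iff algebra_simps)

definition subalgebra :: "('x \<Rightarrow> real) set \<Rightarrow> bool" where
  "subalgebra W \<longleftrightarrow> rfun.subspace W \<and> (\<lambda>_. 1) \<in> W \<and>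
     (\<forall>f\<in>W. \<forall>g\<in>W. (\<lambda>x. f x * g x) \<in> W)"

text \<open>Bilinearity of the product reduces the claim to generators. Keeping \<open>C\<close>
  separate from \<open>B\<close> and \<open>B'\<close> lets degree bounds add up.\<close>

lemma span_mult:
  assumes f: "f \<in> rfun.span B" and g: "g \<in> rfun.span B'"
    and BC: "\<And>b b'. b \<in> B \<Longrightarrow> b' \<in> B' \<Longrightarrow> (\<lambda>x. b x * b' x) \<in> rfun.span C"
  shows "(\<lambda>x. f x * g x) \<in> rfun.span C"
  using f
proof (induction rule: rfun.span_induct_alt)
  case base
  then show ?case using rfun.span_zero[of C] by (simp add: zero_fun_def)
next
  case (step c b f')
  from g have "(\<lambda>x. b x * g x) \<in> rfun.span C"
  proof (induction rule: rfun.span_induct_alt)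
    case base
    then show ?case using rfun.span_zero[of C] by (simp add: zero_fun_def)
  next
    case (step d b' g')
    from rfun.span_add[OF rfun.span_scale[OF BC[OF \<open>b \<in> B\<close> step(1)], of d] step(2)]
    show ?case by (simp add: plus_fun_def algebra_simps)
  qed
  from rfun.span_add[OF rfun.span_scale[OF this, of c] step(2)]
  show ?case by (simp add: plus_fun_def algebra_simps)
qed

lemma subalgebra_span:
  assumes "(\<lambda>_. 1) \<in> rfun.span B"
    and "\<And>b b'. b \<in> B \<Longrightarrow> b' \<in> B \<Longrightarrow> (\<lambda>x. b x * b' x) \<in> rfun.span B"
  shows "subalgebra (rfun.span B)"
  unfolding subalgebra_def using assms span_mult[of _ B _ B B] by auto

lemma subalgebra_power:
  assumes "subalgebra W" "f \<in> W"
  shows "(\<lambda>x. f x ^ k) \<in> W"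
  using assms by (induction k) (auto simp: subalgebra_def)

lemma subalgebra_prod:
  assumes "subalgebra W" "\<And>i. i \<in> I \<Longrightarrow> f i \<in> W"
  shows "(\<lambda>x. \<Prod>i\<in>I. f i x) \<in> W"
  using assms(2)
proof (induction I rule: infinite_finite_induct)
  case (insert i I)
  then show ?case using assms(1) by (auto simp: subalgebra_def)
qed (use assms(1) in \<open>auto simp: subalgebra_def\<close>)

lemma subalgebra_sum:
  assumes "subalgebra W" "\<And>i. i \<in> I \<Longrightarrow> f i \<in> W"
  shows "(\<lambda>x. \<Sum>i\<in>I. f i x) \<in> W"
proof -
  have "(\<Sum>i\<in>I. f i) \<in> W"
    using assms rfun.subspace_sum[of W I f] by (auto simp: subalgebra_def)
  moreover have "(\<Sum>i\<in>I. f i) x = (\<Sum>i\<in>I. f i x)" for x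
    by (induction I rule: infinite_finite_induct) auto
  ultimately show ?thesis by (metis (no_types, lifting) ext)
qed

text \<open>Polynomial expressions stay in a subalgebra. Restricting the hypothesis to
  \<open>poly_vars P\<close> matters for functions read off a list, whose entries are specified only
  below its length.\<close>

lemma subalgebra_poly_eval:
  assumes W: "subalgebra W" and g: "\<And>i. i \<in> poly_vars P \<Longrightarrow> g i \<in> W"
  shows "(\<lambda>x. poly_eval P (\<lambda>i. g i x)) \<in> W"
  unfolding poly_eval_def
proof (rule subalgebra_sum[OF W])
  fix m assume m: "m \<in> Poly_Mapping.keys P"
  have "(\<lambda>x. \<Prod>i\<in>Poly_Mapping.keys m. g i x ^ Poly_Mapping.lookup m i) \<in> W"
    by (rule subalgebra_prod[OF W], rule subalgebra_power[OF W], rule g)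
       (use m in \<open>auto simp: poly_vars_def\<close>)
  then show "(\<lambda>x. Poly_Mapping.lookup P m *
      (\<Prod>i\<in>Poly_Mapping.keys m. g i x ^ Poly_Mapping.lookup m i)) \<in> W"
    using W rfun.subspace_scale[of W] by (auto simp: subalgebra_def)
qed

section \<open>Monomials in a list of functions\<close>

definition mono_fun :: "('x \<Rightarrow> real) list \<Rightarrow> (nat \<Rightarrow> nat) \<Rightarrow> 'x \<Rightarrow> real" where
  "mono_fun qs e x = (\<Prod>i<length qs. (qs ! i) x ^ e i)"

definition gen_algebra :: "('x \<Rightarrow> real) list \<Rightarrow> ('x \<Rightarrow> real) set" where
  "gen_algebra qs = rfun.span (range (mono_fun qs))"

text \<open>Bounding each exponent separately, not the total degree, makes the bound on the number
  of monomials a plain power.\<close>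

definition box_monos :: "('x \<Rightarrow> real) list \<Rightarrow> nat \<Rightarrow> ('x \<Rightarrow> real) set" where
  "box_monos qs D = mono_fun qs ` {e. \<forall>i<length qs. e i \<le> D}"

lemma mono_fun_mult:
  "(\<lambda>x. mono_fun qs e x * mono_fun qs e' x) = mono_fun qs (\<lambda>i. e i + e' i)"
  by (auto simp: mono_fun_def power_add prod.distrib)

lemma mono_fun_zero: "(\<lambda>_. 1) = mono_fun qs (\<lambda>_. 0)"
  by (auto simp: mono_fun_def)

lemma subalgebra_gen_algebra: "subalgebra (gen_algebra qs)"
  unfolding gen_algebra_def
proof (rule subalgebra_span)
  show "(\<lambda>_. 1) \<in> rfun.span (range (mono_fun qs))"
    unfolding mono_fun_zero[of qs] by (rule rfun.span_base) auto
qed (auto simp: mono_fun_mult intro: rfun.span_base)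

lemma nth_in_gen_algebra:
  assumes "i < length qs"
  shows "qs ! i \<in> gen_algebra qs"
proof -
  have "mono_fun qs (\<lambda>j. if j = i then 1 else 0) x = (qs ! i) x" for x
  proof -
    have "mono_fun qs (\<lambda>j. if j = i then 1 else 0) x = (\<Prod>j<length qs. if j = i then (qs ! i) x else 1)"
      unfolding mono_fun_def by (rule prod.cong) auto
    then show ?thesis using assms by simp
  qed
  then have "mono_fun qs (\<lambda>j. if j = i then 1 else 0) = qs ! i" by auto
  then show ?thesis unfolding gen_algebra_def by (metis rangeI rfun.span_base)
qed

lemma gen_algebra_subset:
  assumes W: "subalgebra W" and "set qs \<subseteq> W"
  shows "gen_algebra qs \<subseteq> W"
  unfolding gen_algebra_def
proof (rule rfun.span_minimal)
  show "range (mono_fun qs) \<subseteq> W"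
    unfolding mono_fun_def[abs_def]
    using assms by (auto intro!: subalgebra_prod[OF W] subalgebra_power[OF W])
  show "rfun.subspace W" using W by (simp add: subalgebra_def)
qed

lemma gen_algebra_append: "gen_algebra qs \<subseteq> gen_algebra (qs @ rs)"
proof (rule gen_algebra_subset[OF subalgebra_gen_algebra], rule subsetI)
  fix q assume "q \<in> set qs"
  then obtain i where "i < length qs" "q = qs ! i" by (auto simp: in_set_conv_nth)
  then show "q \<in> gen_algebra (qs @ rs)"
    using nth_in_gen_algebra[of i "qs @ rs"] by (simp add: nth_append)
qed

section \<open>Degree bounds and counting of monomials\<close>

lemma box_monos_mono: "D \<le> D' \<Longrightarrow> box_monos qs D \<subseteq> box_monos qs D'"
  by (force simp: box_monos_def)

lemma span_box_monos_mono:
  "D \<le> D' \<Longrightarrow> f \<in> rfun.span (box_monos qs D) \<Longrightarrow> f \<in> rfun.span (box_monos qs D')"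
  using rfun.span_mono[OF box_monos_mono] by blast

text \<open>Exponents beyond the list do not affect the monomial, so at most \<open>D + 1\<close>
  choices for each list entry remain.\<close>

lemma card_box_monos:
  "finite (box_monos qs D) \<and> card (box_monos qs D) \<le> (D + 1) ^ length qs"
proof -
  let ?E = "PiE {..<length qs} (\<lambda>_. {..D})"
  have "box_monos qs D \<subseteq> mono_fun qs ` ?E"
  proof
    fix f assume "f \<in> box_monos qs D"
    then obtain e where e: "\<forall>i<length qs. e i \<le> D" "f = mono_fun qs e"
      by (auto simp: box_monos_def)
    then have "f = mono_fun qs (restrict e {..<length qs})"
      by (auto simp: mono_fun_def fun_eq_iff intro!: prod.cong)
    moreover have "restrict e {..<length qs} \<in> ?E" using e by auto
    ultimately show "f \<in> mono_fun qs ` ?E" by blast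
  qed
  moreover have "finite ?E" by (simp add: finite_PiE)
  moreover have "card ?E = (D + 1) ^ length qs" by (simp add: card_PiE)
  ultimately show ?thesis
    by (metis card_image_le card_mono finite_imageI finite_subset le_trans)
qed

lemma gen_algebra_bounded:
  assumes "f \<in> gen_algebra qs"
  shows "\<exists>D. f \<in> rfun.span (box_monos qs D)"
  using assms unfolding gen_algebra_def
proof (induction rule: rfun.span_induct_alt)
  case base
  then show ?case using rfun.span_zero by blast
next
  case (step c b f)
  then obtain D e where D: "f \<in> rfun.span (box_monos qs D)" and e: "b = mono_fun qs e" by auto
  \<comment> \<open>The sum of the exponents is a crude bound for each of them.\<close>
  let ?D = "max D (\<Sum>i<length qs. e i)"
  have "e i \<le> ?D" if "i < length qs" for i
    using member_le_sum[of i "{..<length qs}" e] that by (simp add: max.coboundedI2)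
  then have "b \<in> box_monos qs ?D" using e by (auto simp: box_monos_def)
  moreover have "f \<in> rfun.span (box_monos qs ?D)"
    by (rule span_box_monos_mono[OF _ D]) simp
  ultimately show ?case
    by (intro exI[of _ ?D] rfun.span_add rfun.span_scale) (auto intro: rfun.span_base)
qed

lemma span_box_monos_mult:
  assumes "f \<in> rfun.span (box_monos qs D)" "g \<in> rfun.span (box_monos qs D')"
  shows "(\<lambda>x. f x * g x) \<in> rfun.span (box_monos qs (D + D'))"
proof (rule span_mult[OF assms])
  fix b b' assume "b \<in> box_monos qs D" "b' \<in> box_monos qs D'"
  then show "(\<lambda>x. b x * b' x) \<in> rfun.span (box_monos qs (D + D'))"
    by (auto simp: box_monos_def mono_fun_mult intro!: rfun.span_base imageI add_mono)
qed

lemma one_in_span_box_monos: "(\<lambda>_. 1) \<in> rfun.span (box_monos qs D)"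
  unfolding mono_fun_zero[of qs] by (rule rfun.span_base) (auto simp: box_monos_def)

lemma span_box_monos_power:
  assumes "f \<in> rfun.span (box_monos qs D)"
  shows "(\<lambda>x. f x ^ k) \<in> rfun.span (box_monos qs (k * D))"
proof (induction k)
  case (Suc k)
  then show ?case using span_box_monos_mult[OF assms Suc] by simp
qed (simp add: one_in_span_box_monos)

lemma span_box_monos_prod:
  assumes "\<And>i. i \<in> I \<Longrightarrow> f i \<in> rfun.span (box_monos qs (d i))"
  shows "(\<lambda>x. \<Prod>i\<in>I. f i x) \<in> rfun.span (box_monos qs (\<Sum>i\<in>I. d i))"
  using assms
proof (induction I rule: infinite_finite_induct)
  case (insert i I)
  then show ?case using span_box_monos_mult[of "f i" qs "d i"] by simp
qed (auto simp: one_in_span_box_monos)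

section \<open>Multiplicative independence modulo squares\<close>

text \<open>Linear independence over the field with two elements, in the multiplicative group of
  positive rationals modulo squares.\<close>

definition square_indep :: "nat set \<Rightarrow> bool" where
  "square_indep A \<longleftrightarrow> finite A \<and> 0 \<notin> A \<and> (\<forall>B\<subseteq>A. B \<noteq> {} \<longrightarrow> (\<nexists>t. \<Prod>B = t ^ 2))"

lemma square_cofactor:
  fixes x y z :: nat
  assumes "x * y ^ 2 = z ^ 2" "y \<noteq> 0"
  shows "\<exists>t. x = t ^ 2"
proof -
  have "y ^ 2 dvd z ^ 2" using assms(1) by (metis dvd_triv_right)
  then have "y dvd z" by simp
  then obtain w where "z = y * w" by (auto elim: dvdE)
  then have "x = w ^ 2" using assms by (auto simp: power_mult_distrib)
  then show ?thesis by blast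
qed

lemma parity_power: "(if odd n then a else 1) * (a ^ (n div 2)) ^ 2 = a ^ n"
  for a :: "'a::comm_monoid_mult"
proof (cases "odd n")
  case True
  then have "n = Suc (2 * (n div 2))" by simp
  then have "a ^ n = a * a ^ (2 * (n div 2))" by (metis power_Suc)
  then show ?thesis using True by (simp only: power_even_eq if_True not_False_eq_True)
next
  case False
  then have "n = 2 * (n div 2)" by simp
  then have "a ^ n = a ^ (2 * (n div 2))" by simp
  then show ?thesis using False by (simp only: power_even_eq if_False mult_1)
qed

text \<open>By descent: the exponents agree in parity, and after cancelling the parity parts and
  taking square roots the halved exponents satisfy the same equation. Independence modulo squares
  thus gives full multiplicative independence.\<close>

lemma square_indep_exponents:
  fixes k l :: "nat \<Rightarrow> nat"
  assumes A: "square_indep A" and eq: "(\<Prod>a\<in>A. a ^ k a) = (\<Prod>a\<in>A. a ^ l a)"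
  shows "\<forall>a\<in>A. k a = l a"
  using eq
proof (induction "\<Sum>a\<in>A. k a + l a" arbitrary: k l rule: less_induct)
  case less
  have fin: "finite A" and "0 \<notin> A" using A by (auto simp: square_indep_def)
  then have pos: "a \<noteq> 0" if "a \<in> A" for a using that by metis
  show ?case
  proof (cases "(\<Sum>a\<in>A. k a + l a) = 0")
    case True
    then show ?thesis using fin by simp
  next
    case False
    \<comment> \<open>Both sides multiplied together give a square. Splitting off
      \<open>y ^ 2\<close> leaves \<open>\<Prod>B\<close>, which is then a square too, so
      independence makes \<open>B\<close> empty.\<close>
    define B where "B = {a\<in>A. odd (k a + l a)}"
    define y where "y = (\<Prod>a\<in>A. a ^ ((k a + l a) div 2))"
    have y0: "y \<noteq> 0" using fin pos by (auto simp: y_def)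
    have "\<Prod>B = (\<Prod>a\<in>A. if odd (k a + l a) then a else 1)"
      unfolding B_def using fin by (simp add: prod.inter_filter)
    then have "\<Prod>B * y ^ 2 = (\<Prod>a\<in>A. (if odd (k a + l a) then a else 1) * (a ^ ((k a + l a) div 2)) ^ 2)"
      by (simp add: y_def prod.distrib prod_power_distrib)
    also have "\<dots> = (\<Prod>a\<in>A. a ^ k a * a ^ l a)"
    proof (rule prod.cong[OF refl])
      fix a
      show "(if odd (k a + l a) then a else 1) * (a ^ ((k a + l a) div 2)) ^ 2 = a ^ k a * a ^ l a"
        unfolding power_add[symmetric] by (rule parity_power)
    qed
    also have "\<dots> = (\<Prod>a\<in>A. a ^ k a) ^ 2"
      using less.prems by (simp add: prod.distrib power2_eq_square)
    finally have "\<exists>t. \<Prod>B = t ^ 2" using square_cofactor y0 by blast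
    moreover have "B \<subseteq> A" by (auto simp: B_def)
    ultimately have "B = {}" using A unfolding square_indep_def by blast
    then have par: "odd (k a) = odd (l a)" if "a \<in> A" for a using that by (auto simp: B_def)
    have half: "(\<Prod>a\<in>A. a ^ h a) = (\<Prod>a\<in>A. a ^ (h a div 2)) ^ 2 * (\<Prod>a\<in>A. a ^ (h a mod 2))" for h
      unfolding prod_power_distrib prod.distrib[symmetric]
      by (rule prod.cong[OF refl]) (simp add: power_mult[symmetric] power_add[symmetric])
    \<comment> \<open>Equal parities make the remainder factors cancel, and natural numbers with
      equal squares are equal.\<close>
    have "(\<Prod>a\<in>A. a ^ (k a mod 2)) = (\<Prod>a\<in>A. a ^ (l a mod 2))"
      by (rule prod.cong[OF refl]) (use par in \<open>simp add: mod2_eq_if\<close>)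
    moreover have "(\<Prod>a\<in>A. a ^ (l a mod 2)) \<noteq> 0" using fin pos by auto
    ultimately have "(\<Prod>a\<in>A. a ^ (k a div 2)) = (\<Prod>a\<in>A. a ^ (l a div 2))"
      using less.prems half[of k] half[of l] by simp
    moreover have "(\<Sum>a\<in>A. k a div 2 + l a div 2) < (\<Sum>a\<in>A. k a + l a)"
    proof -
      have le: "\<forall>a\<in>A. k a div 2 + l a div 2 \<le> k a + l a"
        by (simp add: add_le_mono)
      have "\<exists>a\<in>A. k a + l a \<noteq> 0" using False by (rule contrapos_np) simp
      then obtain a where a: "a \<in> A" "k a + l a \<noteq> 0" by blast
      have "m div 2 + n div 2 < m + n" if "m + n \<noteq> 0" for m n :: nat
        using that by presburger
      from this[OF a(2)] show ?thesis
        by (intro sum_strict_mono_ex1[OF fin le] bexI[OF _ a(1)])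
    qed
    ultimately have halves: "\<forall>a\<in>A. k a div 2 = l a div 2"
      using less.hyps[where k = "\<lambda>a. k a div 2" and l = "\<lambda>a. l a div 2"] by blast
    show ?thesis
    proof
      fix a assume "a \<in> A"
      then have "k a div 2 = l a div 2" "odd (k a) = odd (l a)" using halves par by auto
      then show "k a = l a" by presburger
    qed
  qed
qed

section \<open>Infinitesimal points and leading terms\<close>

locale prime_labelling =
  fixes \<pi> :: "'u::finite \<Rightarrow> nat"
  assumes prime_label: "prime (\<pi> u)" and inj_label: "inj \<pi>"
begin

text \<open>A variant of the Liouville function that counts, with multiplicity, only the prime
  factors labelled by \<open>S\<close>.\<close>

definition flip_sign :: "'u set \<Rightarrow> nat \<Rightarrow> real" where
  "flip_sign S j = (\<Prod>u\<in>UNIV. if u \<in> S then (-1) ^ multiplicity (\<pi> u) j else 1)"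

text \<open>A pair \<open>(S, k)\<close> encodes a point that approaches the origin as
  \<open>k\<close> grows. Distinct primes make the decay rates multiplicatively independent, so
  distinct monomials decay at distinct rates.\<close>

definition coord :: "'u \<Rightarrow> 'u set \<times> nat \<Rightarrow> real" where
  "coord u = (\<lambda>(S, k). (if u \<in> S then - 1 else 1) * (1 / real (\<pi> u)) ^ k)"

definition term_fun :: "nat \<Rightarrow> 'u set \<times> nat \<Rightarrow> real" where
  "term_fun j = (\<lambda>(S, k). flip_sign S j * (1 / real j) ^ k)"

definition dirichlet :: "('u set \<times> nat \<Rightarrow> real) set" where
  "dirichlet = rfun.span (term_fun ` {0<..})"

text \<open>Asymptotically \<open>f (S, k)\<close> is \<open>c * flip_sign S j / j ^ k\<close>. One
  pair \<open>(j, c)\<close> serves all \<open>S\<close>, so the sign pattern enters the leading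
  term only through \<open>flip_sign\<close>.\<close>

definition leads :: "('u set \<times> nat \<Rightarrow> real) \<Rightarrow> nat \<Rightarrow> real \<Rightarrow> bool" where
  "leads f j c \<longleftrightarrow> 0 < j \<and> c \<noteq> 0 \<and>
     (\<forall>S. (\<lambda>k. f (S, k) * real j ^ k) \<longlonglongrightarrow> c * flip_sign S j)"

section \<open>Sign characters\<close>

lemma flip_sign_mult:
  assumes "i \<noteq> 0" "j \<noteq> 0"
  shows "flip_sign S (i * j) = flip_sign S i * flip_sign S j"
  unfolding flip_sign_def prod.distrib[symmetric]
  by (rule prod.cong[OF refl])
     (use assms prime_label in \<open>auto simp: prime_elem_multiplicity_mult_distrib power_add\<close>)

lemma flip_sign_one [simp]: "flip_sign S (Suc 0) = 1"
  unfolding flip_sign_def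
  by (rule prod.neutral) (use multiplicity_one[of "\<pi> _"] in simp)

lemma flip_sign_empty [simp]: "flip_sign {} j = 1"
  by (simp add: flip_sign_def)

text \<open>A label in both sets contributes the same power of -1 twice, which cancels. Sets under
  symmetric difference thus act as a group of characters.\<close>

lemma flip_sign_sym_diff:
  "flip_sign ((S - S') \<union> (S' - S)) j = flip_sign S j * flip_sign S' j"
  unfolding flip_sign_def prod.distrib[symmetric]
  by (rule prod.cong[OF refl]) (auto simp: power_mult_distrib[symmetric])

lemma flip_sign_cases: "flip_sign S j = 1 \<or> flip_sign S j = - 1"
proof -
  have "flip_sign S j * flip_sign S j = 1" using flip_sign_sym_diff[of S S j] by simp
  then show ?thesis by (simp add: square_eq_1_iff power2_eq_square)
qed

lemma flip_sign_square: "t \<noteq> 0 \<Longrightarrow> flip_sign S (t ^ 2) = 1"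
  using flip_sign_cases[of S t] by (auto simp: power2_eq_square flip_sign_mult)

lemma flip_sign_prod:
  "(\<And>a. a \<in> A \<Longrightarrow> a \<noteq> 0) \<Longrightarrow> flip_sign S (\<Prod>A) = (\<Prod>a\<in>A. flip_sign S a)"
proof (induction A rule: infinite_finite_induct)
  case (insert a A)
  then have "\<Prod>A \<noteq> 0" "a \<noteq> 0" using prod_zero_iff[of A "\<lambda>x. x"] by blast+
  then show ?case using insert flip_sign_mult[of a "\<Prod>A" S] by auto
qed auto

lemma flip_sign_label: "flip_sign S (\<pi> u) = (if u \<in> S then - 1 else 1)"
proof -
  have "multiplicity (\<pi> v) (\<pi> u) = (if v = u then 1 else 0)" for v
    using prime_multiplicity_other[OF prime_label prime_label] injD[OF inj_label, of v u]
      multiplicity_prime[of "\<pi> u"] prime_label[of u]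
    by auto
  then have "flip_sign S (\<pi> u) = (\<Prod>v\<in>UNIV. if v = u then (if u \<in> S then - 1 else 1) else 1)"
    unfolding flip_sign_def by (intro prod.cong) auto
  then show ?thesis by simp
qed

text \<open>This places polynomials in the coordinates inside \<open>dirichlet\<close>.\<close>

lemma coord_eq_term_fun: "coord u = term_fun (\<pi> u)"
  by (auto simp: coord_def term_fun_def flip_sign_label)

text \<open>The terms with indices \<open>i\<close> and \<open>j\<close> multiply to the term with
  index \<open>i * j\<close>, so the generators form a monoid.\<close>

lemma subalgebra_dirichlet: "subalgebra dirichlet"
  unfolding dirichlet_def
proof (rule subalgebra_span)
  have "(\<lambda>_. 1) = term_fun 1" by (auto simp: term_fun_def)
  then show "(\<lambda>_. 1) \<in> rfun.span (term_fun ` {0<..})" by (auto intro: rfun.span_base)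
next
  fix b b' assume "b \<in> term_fun ` {0<..}" "b' \<in> term_fun ` {0<..}"
  then obtain i j where ij: "b = term_fun i" "b' = term_fun j" "i > 0" "j > 0" by auto
  have "(\<lambda>x. b x * b' x) = term_fun (i * j)"
    using ij by (auto simp: term_fun_def flip_sign_mult power_mult_distrib fun_eq_iff power_divide)
  then show "(\<lambda>x. b x * b' x) \<in> rfun.span (term_fun ` {0<..})"
    using ij by (auto intro!: rfun.span_base)
qed

lemma coord_in_dirichlet: "coord u \<in> dirichlet"
  unfolding coord_eq_term_fun dirichlet_def
  using prime_gt_0_nat[OF prime_label] by (auto intro: rfun.span_base)

section \<open>Calculus of leading terms\<close>

lemma leads_term_fun: "0 < j \<Longrightarrow> leads (term_fun j) j 1"
  by (auto simp: leads_def term_fun_def power_divide)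

lemma leads_mult:
  assumes "leads f i c" "leads g j d"
  shows "leads (\<lambda>x. f x * g x) (i * j) (c * d)"
proof -
  have "(\<lambda>k. (f (S, k) * g (S, k)) * real (i * j) ^ k) \<longlonglongrightarrow> (c * d) * flip_sign S (i * j)" for S
  proof -
    have "(\<lambda>k. (f (S, k) * real i ^ k) * (g (S, k) * real j ^ k))
        \<longlonglongrightarrow> (c * flip_sign S i) * (d * flip_sign S j)"
      using assms unfolding leads_def by (intro tendsto_mult[where f = "\<lambda>k. f (S, k) * real i ^ k"]) blast+
    then show ?thesis
      using assms by (simp add: leads_def flip_sign_mult power_mult_distrib mult_ac)
  qed
  then show ?thesis using assms by (auto simp: leads_def)
qed

lemma leads_const_one: "leads (\<lambda>_. 1) 1 1"
  by (auto simp: leads_def)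

lemma leads_power: "leads f j c \<Longrightarrow> leads (\<lambda>x. f x ^ k) (j ^ k) (c ^ k)"
proof (induction k)
  case (Suc k)
  then show ?case using leads_mult[of f j c] by simp
qed (use leads_const_one in simp)

lemma leads_prod:
  assumes "\<And>i. i \<in> I \<Longrightarrow> leads (f i) (j i) (c i)"
  shows "leads (\<lambda>x. \<Prod>i\<in>I. f i x) (\<Prod>i\<in>I. j i) (\<Prod>i\<in>I. c i)"
  using assms
proof (induction I rule: infinite_finite_induct)
  case (insert i I)
  then show ?case using leads_mult[of "f i" "j i" "c i"] by simp
qed (use leads_const_one in auto)

lemma leads_nonzero: "leads f j c \<Longrightarrow> f \<noteq> 0"
proof
  assume "leads f j c" "f = 0"
  then have "(\<lambda>k. f ({}, k) * real j ^ k) \<longlonglongrightarrow> c * flip_sign {} j" "c \<noteq> 0"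
    unfolding leads_def by blast+
  then show False using \<open>f = 0\<close> by (simp add: LIMSEQ_const_iff)
qed

text \<open>Distinct leading indices cannot cancel: after scaling by the power of the smallest index
  with nonzero weight, every other summand tends to zero.\<close>

lemma leads_sum:
  assumes fin: "finite I" and inj: "inj_on j I"
    and lead: "\<And>i. i \<in> I \<Longrightarrow> leads (g i) (j i) (c i)"
    and ex: "\<exists>i\<in>I. w i \<noteq> 0"
  shows "\<exists>i\<in>I. leads (\<lambda>x. \<Sum>i\<in>I. w i * g i x) (j i) (w i * c i)"
proof -
  define I' where "I' = {i\<in>I. w i \<noteq> 0}"
  have "finite I'" "I' \<noteq> {}" using fin ex by (auto simp: I'_def)
  then obtain i0 where i0: "i0 \<in> I'" "\<And>i. i \<in> I' \<Longrightarrow> j i0 \<le> j i"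
    using arg_min_if_finite[of I' j] by (metis linorder_not_le)
  have i0I: "i0 \<in> I" using i0 by (simp add: I'_def)
  have "(\<lambda>k. (\<Sum>i\<in>I. w i * g i (S, k)) * real (j i0) ^ k) \<longlonglongrightarrow> (w i0 * c i0) * flip_sign S (j i0)" for S
  proof -
    have each: "(\<lambda>k. w i * g i (S, k) * real (j i0) ^ k)
        \<longlonglongrightarrow> (if i = i0 then w i0 * c i0 * flip_sign S (j i0) else 0)" if i: "i \<in> I" for i
    proof (cases "i = i0")
      case True
      have "(\<lambda>k. w i0 * (g i0 (S, k) * real (j i0) ^ k)) \<longlonglongrightarrow> w i0 * (c i0 * flip_sign S (j i0))"
        using lead[OF i0I] by (intro tendsto_mult_left) (auto simp: leads_def)
      then show ?thesis using True by (simp add: mult.assoc)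
    next
      case False
      show ?thesis
      proof (cases "w i = 0")
        case nz: False
        then have "j i0 \<le> j i" using i i0 by (auto simp: I'_def)
        moreover have "j i0 \<noteq> j i" using inj i i0I False by (auto dest: inj_onD)
        ultimately have lt: "j i0 < j i" by simp
        have pos: "0 < j i" using lead[OF i] by (auto simp: leads_def)
        have "(\<lambda>k. (real (j i0) / real (j i)) ^ k) \<longlonglongrightarrow> 0"
          by (rule LIMSEQ_realpow_zero) (use lt pos in auto)
        moreover have "(\<lambda>k. g i (S, k) * real (j i) ^ k) \<longlonglongrightarrow> c i * flip_sign S (j i)"
          using lead[OF i] by (auto simp: leads_def)
        ultimately have "(\<lambda>k. w i * ((g i (S, k) * real (j i) ^ k) * (real (j i0) / real (j i)) ^ k))
            \<longlonglongrightarrow> w i * ((c i * flip_sign S (j i)) * 0)"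
          using tendsto_mult_left tendsto_mult by blast
        then show ?thesis using False pos by (simp add: power_divide mult.assoc)
      qed (use False in simp)
    qed
    have "(\<lambda>k. \<Sum>i\<in>I. w i * g i (S, k) * real (j i0) ^ k)
        \<longlonglongrightarrow> (\<Sum>i\<in>I. if i = i0 then w i0 * c i0 * flip_sign S (j i0) else 0)"
      by (rule tendsto_sum[OF each])
    then show ?thesis using fin i0I by (simp add: sum_distrib_right)
  qed
  then have "leads (\<lambda>x. \<Sum>i\<in>I. w i * g i x) (j i0) (w i0 * c i0)"
    using lead[OF i0I] i0 by (auto simp: leads_def I'_def)
  then show ?thesis using i0I by blast
qed

section \<open>Leading terms, signs and linear independence\<close>

lemma rfun_sum_apply: "(\<Sum>i\<in>I. (\<lambda>x. w i * g i x)) = (\<lambda>x. \<Sum>i\<in>I. w i * (g i x :: real))"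
proof
  show "(\<Sum>i\<in>I. (\<lambda>x. w i * g i x)) x = (\<Sum>i\<in>I. w i * g i x)" for x
    by (induction I rule: infinite_finite_induct) auto
qed

text \<open>The terms of a finite Dirichlet sum lead with their own, distinct indices, so
  \<open>leads_sum\<close> applies.\<close>

lemma dirichlet_leads:
  assumes "f \<in> dirichlet" "f \<noteq> 0"
  shows "\<exists>j c. leads f j c"
proof -
  from assms(1) obtain t w where t: "finite t" "t \<subseteq> term_fun ` {0<..}"
      and f: "f = (\<Sum>b\<in>t. (\<lambda>x. w b * b x))"
    unfolding dirichlet_def rfun.span_explicit by auto
  \<comment> \<open>Representatives on which \<open>term_fun\<close> is injective turn the sum over
    functions into a sum over indices.\<close>
  obtain J where J: "J \<subseteq> {0<..}" "inj_on term_fun J" "t = term_fun ` J"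
    using t(2) by (auto simp: subset_image_inj)
  then have finJ: "finite J" using t(1) finite_imageD by blast
  have f': "f = (\<lambda>x. \<Sum>i\<in>J. w (term_fun i) * term_fun i x)"
    unfolding f rfun_sum_apply J(3) sum.reindex[OF J(2)] by simp
  have "\<exists>i\<in>J. w (term_fun i) \<noteq> 0"
    using assms(2) f' by (auto simp: zero_fun_def)
  then have "\<exists>i\<in>J. leads (\<lambda>x. \<Sum>i\<in>J. w (term_fun i) * term_fun i x) i (w (term_fun i) * 1)"
    using J(1) by (intro leads_sum[OF finJ] leads_term_fun) auto
  then show ?thesis unfolding f'[symmetric] by blast
qed

text \<open>Scaling by the positive number \<open>j ^ k\<close> keeps signs, and the scaled values
  converge to a nonzero limit.\<close>

lemma leads_sgn:
  assumes "leads f j c"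
  shows "\<forall>\<^sub>F k in sequentially. sgn (f (S, k)) = sgn (c * flip_sign S j)"
proof -
  let ?L = "c * flip_sign S j"
  have lim: "(\<lambda>k. f (S, k) * real j ^ k) \<longlonglongrightarrow> ?L" and j: "0 < j"
    and L: "?L \<noteq> 0" using assms flip_sign_cases[of S j] by (auto simp: leads_def)
  have sg: "sgn (f (S, k)) = sgn (f (S, k) * real j ^ k)" for k
    using j by (simp add: sgn_mult)
  show ?thesis
  proof (cases "?L > 0")
    case True
    then show ?thesis using order_tendstoD(1)[OF lim True] unfolding sg
      by (auto elim!: eventually_mono)
  next
    case False
    then have neg: "?L < 0" using L by linarith
    then show ?thesis using order_tendstoD(2)[OF lim neg] unfolding sg
      by (auto elim!: eventually_mono)
  qed
qed

text \<open>By \<open>leads_sum\<close>, a nontrivial combination has a leading term and is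
  therefore nonzero.\<close>

lemma distinct_leads_independent:
  assumes fin: "finite I" and inj: "inj_on j I"
    and lead: "\<And>i. i \<in> I \<Longrightarrow> leads (g i) (j i) (c i)"
  shows "inj_on g I \<and> rfun.independent (g ` I)"
proof
  show injg: "inj_on g I"
  proof (rule inj_onI, rule ccontr)
    fix a b assume ab: "a \<in> I" "b \<in> I" "g a = g b" "a \<noteq> b"
    \<comment> \<open>With these weights, equality of \<open>g a\<close> and \<open>g b\<close>
      would make a combination with a leading term vanish.\<close>
    let ?w = "\<lambda>i. if i = a then 1 else if i = b then - 1 else (0::real)"
    have "\<exists>i\<in>{a, b}. leads (\<lambda>x. \<Sum>i\<in>{a, b}. ?w i * g i x) (j i) (?w i * c i)"
      by (rule leads_sum) (use ab lead inj in \<open>auto simp: inj_on_def\<close>)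
    then obtain i where "leads (\<lambda>x. \<Sum>i\<in>{a, b}. ?w i * g i x) (j i) (?w i * c i)" by blast
    from leads_nonzero[OF this] ab show False by (auto simp: zero_fun_def)
  qed
  show "rfun.independent (g ` I)"
  proof
    assume "rfun.dependent (g ` I)"
    then obtain w where w: "\<exists>v\<in>g ` I. w v \<noteq> 0" "(\<Sum>v\<in>g ` I. (\<lambda>x. w v * v x)) = 0"
      unfolding rfun.dependent_finite[OF finite_imageI[OF fin]] by blast
    have "(\<Sum>v\<in>g ` I. (\<lambda>x. w v * v x)) = (\<lambda>x. \<Sum>i\<in>I. w (g i) * g i x)"
      unfolding rfun_sum_apply sum.reindex[OF injg] by simp
    moreover from w(1) have "\<exists>i\<in>I. w (g i) \<noteq> 0" by auto
    ultimately show False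
      using leads_sum[OF fin inj lead, of "\<lambda>i. w (g i)"] leads_nonzero w(2) by metis
  qed
qed

text \<open>
  Products of powers of functions with square-independent leading indices are linearly
  independent, while there are too few monomials in fewer functions to span them.
\<close>

lemma card_square_indep_leads:
  assumes A: "square_indep A"
    and lead: "\<And>a. a \<in> A \<Longrightarrow> \<exists>f\<in>gen_algebra qs. \<exists>c. leads f a c"
  shows "card A \<le> length qs"
proof (rule ccontr)
  assume "\<not> card A \<le> length qs"
  then obtain A' where A': "A' \<subseteq> A" "card A' = Suc (length qs)" "finite A'"
    using obtain_subset_with_card_n[of "Suc (length qs)" A] by (auto simp: not_le Suc_le_eq)
  have A'_indep: "square_indep A'"
    using A A'(1,3) unfolding square_indep_def by blast
  obtain f c where f: "\<And>a. a \<in> A' \<Longrightarrow> f a \<in> gen_algebra qs"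
    and fc: "\<And>a. a \<in> A' \<Longrightarrow> leads (f a) a (c a)"
    using lead A'(1) by (metis subsetD)
  have "\<forall>a\<in>A'. \<exists>D. f a \<in> rfun.span (box_monos qs D)"
    using gen_algebra_bounded f by blast
  from bchoice[OF this] obtain d
    where d: "\<And>a. a \<in> A' \<Longrightarrow> f a \<in> rfun.span (box_monos qs (d a))" by blast
  define D where "D = (\<Sum>a\<in>A'. d a)"
  \<comment> \<open>With \<open>r = length qs\<close>, \<open>K\<close> exponents for each of the
    \<open>r + 1\<close> elements of \<open>A'\<close> give \<open>K ^ (r + 1)\<close> products, all
    in the span of at most \<open>(K * M) ^ r\<close> monomials. Taking \<open>K\<close> above
    \<open>M ^ r\<close> makes this impossible.\<close>
  define M where "M = D * card A' + 1"
  define K where "K = M ^ length qs + 1"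
  define I where "I = PiE A' (\<lambda>_. {..<K})"
  define g where "g k = (\<lambda>x. \<Prod>a\<in>A'. f a x ^ k a)" for k
  have finI: "finite I" and cardI: "card I = K ^ Suc (length qs)"
    using A' by (auto simp: I_def finite_PiE card_PiE)
  have leads_g: "leads (g k) (\<Prod>a\<in>A'. a ^ k a) (\<Prod>a\<in>A'. c a ^ k a)" for k
    unfolding g_def by (intro leads_prod leads_power fc)
  \<comment> \<open>Square independence gives products with different exponents different leading
    indices.\<close>
  have "inj_on (\<lambda>k. \<Prod>a\<in>A'. a ^ k a) I"
    using square_indep_exponents[OF A'_indep] unfolding I_def
    by (intro inj_onI PiE_ext) blast+
  from distinct_leads_independent[OF finI this leads_g]
  have ind: "inj_on g I" "rfun.independent (g ` I)" by auto
  have dD: "d a \<le> D" if "a \<in> A'" for a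
    unfolding D_def using member_le_sum[of a A' d] A'(3) that by simp
  have "g ` I \<subseteq> rfun.span (box_monos qs (K * D * card A'))"
  proof
    fix h assume "h \<in> g ` I"
    then obtain k where k: "k \<in> I" "h = g k" by auto
    have "g k \<in> rfun.span (box_monos qs (\<Sum>a\<in>A'. k a * d a))"
      unfolding g_def by (intro span_box_monos_prod span_box_monos_power d)
    moreover have "(\<Sum>a\<in>A'. k a * d a) \<le> (\<Sum>a\<in>A'. K * D)"
      using k dD by (intro sum_mono mult_mono) (auto simp: I_def PiE_def Pi_def less_imp_le)
    then have "(\<Sum>a\<in>A'. k a * d a) \<le> K * D * card A'" by (simp add: mult.commute)
    ultimately show "h \<in> rfun.span (box_monos qs (K * D * card A'))"
      unfolding k(2) by (rule span_box_monos_mono[rotated])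
  qed
  then have "card (g ` I) \<le> card (box_monos qs (K * D * card A'))"
    using rfun.independent_span_bound ind(2) card_box_monos by blast
  also have "\<dots> \<le> (K * D * card A' + 1) ^ length qs"
    using card_box_monos by blast
  also have "\<dots> \<le> (K * M) ^ length qs"
    by (intro power_mono) (auto simp: M_def K_def algebra_simps)
  also have "\<dots> < K ^ length qs * K"
    unfolding power_mult_distrib by (rule mult_strict_left_mono) (simp_all add: K_def)
  finally show False using ind(1) cardI by (simp add: card_image)
qed

section \<open>Sign flips hidden from few functions\<close>

lemma exists_trivial_flip:
  assumes "card A < CARD('u)" "finite A"
  shows "\<exists>S. S \<noteq> {} \<and> (\<forall>a\<in>A. flip_sign S a = 1)"
proof -
  \<comment> \<open>Pigeonhole: the \<open>2 ^ CARD('u)\<close> sign patterns yield at most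
    \<open>2 ^ card A\<close> subsets of \<open>A\<close>, so two patterns have equal signs on all
    of \<open>A\<close>. Their symmetric difference carries the product of these signs, which is
    1.\<close>
  let ?F = "\<lambda>S. {a\<in>A. flip_sign S a = 1}"
  have "card (range ?F) \<le> card (Pow A)" using assms by (intro card_mono) auto
  also have "\<dots> < card (UNIV :: 'u set set)"
    using assms by (simp add: card_Pow Pow_UNIV[symmetric] del: Pow_UNIV)
  finally have "\<not> inj ?F" using card_image[of ?F UNIV] by auto
  then obtain S S' where S: "S \<noteq> S'" "?F S = ?F S'" by (auto simp: inj_def)
  let ?R = "(S - S') \<union> (S' - S)"
  have "flip_sign ?R a = 1" if "a \<in> A" for a
  proof -
    have "flip_sign S a = 1 \<longleftrightarrow> flip_sign S' a = 1" using S(2) that by blast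
    then show ?thesis unfolding flip_sign_sym_diff
      using flip_sign_cases[of S a] flip_sign_cases[of S' a] by auto
  qed
  moreover have "?R \<noteq> {}" using S(1) by auto
  ultimately show ?thesis by (intro exI[of _ ?R]) simp
qed

text \<open>The threshold for \<open>k\<close> may depend on \<open>f\<close>; a vertex has finitely
  many tests, so they share a threshold.\<close>

definition undetected :: "'u set \<Rightarrow> ('u set \<times> nat \<Rightarrow> real) list \<Rightarrow> bool" where
  "undetected S qs \<longleftrightarrow> (\<forall>f\<in>gen_algebra qs.
     \<forall>\<^sub>F k in sequentially. sgn (f (S, k)) = sgn (f ({}, k)))"

lemma undetected_appendD: "undetected S (qs @ rs) \<Longrightarrow> undetected S qs"
  using gen_algebra_append by (auto simp: undetected_def)

text \<open>A maximal square-independent set \<open>A\<close> of leading indices has at most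
  \<open>length qs\<close> elements, so some nonempty \<open>S\<close> has trivial signs on
  \<open>A\<close>. By maximality every other leading index is, modulo squares, a product of
  elements of \<open>A\<close>, so its sign is trivial too.\<close>

lemma exists_undetected:
  assumes qs: "set qs \<subseteq> dirichlet" and len: "length qs < CARD('u)"
  shows "\<exists>S. S \<noteq> {} \<and> undetected S qs"
proof -
  define L where "L = {j. \<exists>f\<in>gen_algebra qs. \<exists>c. leads f j c}"
  define Q where "Q A \<longleftrightarrow> A \<subseteq> L \<and> square_indep A" for A
  have bound: "card A \<le> length qs" if "Q A" for A
    using that card_square_indep_leads[of A qs] by (auto simp: Q_def L_def)
  have "Q {}" by (auto simp: Q_def square_indep_def)
  then obtain A where A: "Q A" and max: "\<And>A'. Q A' \<Longrightarrow> card A' \<le> card A"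
    using ex_has_greatest_nat[of Q "{}" card "Suc (length qs)"] bound by (auto simp: le_imp_less_Suc)
  have finA: "finite A" and A0: "0 \<notin> A" using A by (auto simp: Q_def square_indep_def)
  obtain S where S: "S \<noteq> {}" "\<And>a. a \<in> A \<Longrightarrow> flip_sign S a = 1"
    using exists_trivial_flip[of A] bound[OF A] len finA by auto
  have triv: "flip_sign S j = 1" if j: "j \<in> L" for j
  proof (cases "j \<in> A")
    case False
    have j0: "0 < j" using j by (auto simp: L_def leads_def)
    have "\<not> Q (insert j A)" using max[of "insert j A"] False finA by auto
    then have "\<not> square_indep (insert j A)" using A j by (auto simp: Q_def)
    then obtain B t where B: "B \<subseteq> insert j A" "B \<noteq> {}" "\<Prod>B = t ^ 2"
      using finA A0 j0 by (auto simp: square_indep_def)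
    \<comment> \<open>Since \<open>A\<close> is independent, a dependence in
      \<open>insert j A\<close> must involve \<open>j\<close>.\<close>
    have "j \<in> B"
      using A B by (auto simp: Q_def square_indep_def)
    have finB: "finite B" using B finA finite_subset by blast
    have B0: "a \<noteq> 0" if "a \<in> B" for a using B that A0 j0 by auto
    then have "\<Prod>B \<noteq> 0" using finB by auto
    then have "t \<noteq> 0" using B(3) by auto
    then have "1 = flip_sign S (\<Prod>B)" using B(3) flip_sign_square by simp
    also have "\<dots> = (\<Prod>a\<in>B. flip_sign S a)" using B0 by (rule flip_sign_prod)
    also have "\<dots> = flip_sign S j * (\<Prod>a\<in>B - {j}. flip_sign S a)"
      using finB \<open>j \<in> B\<close> by (rule prod.remove)
    also have "(\<Prod>a\<in>B - {j}. flip_sign S a) = 1"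
      using S(2) B(1) by (intro prod.neutral) auto
    finally show ?thesis by simp
  qed (use S in simp)
  have "\<forall>\<^sub>F k in sequentially. sgn (f (S, k)) = sgn (f ({}, k))" if f: "f \<in> gen_algebra qs" for f
  proof (cases "f = 0")
    case False
    have "f \<in> dirichlet" using gen_algebra_subset[OF subalgebra_dirichlet qs] f by auto
    then obtain j c where lead: "leads f j c" using dirichlet_leads False by blast
    then have "flip_sign S j = 1" using f triv by (auto simp: L_def)
    with leads_sgn[OF lead, of S] leads_sgn[OF lead, of "{}"] show ?thesis
      by (auto elim: eventually_elim2)
  qed simp
  then have "undetected S qs" unfolding undetected_def by blast
  then show ?thesis using S(1) by blast
qed

text \<open>This fixes the path to follow: on positive points each test eventually has a constant
  outcome.\<close>

lemma sgn_eventually_const: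
  assumes "f \<in> dirichlet"
  shows "\<exists>s. \<forall>\<^sub>F k in sequentially. sgn (f ({}, k)) = s"
proof (cases "f = 0")
  case False
  then obtain j c where "leads f j c" using assms dirichlet_leads by blast
  then show ?thesis using leads_sgn by blast
qed auto

end

section \<open>Protocols on infinitesimal points\<close>

locale input_labelling = prime_labelling \<pi> for \<pi> :: "'m::finite + 'n::finite \<Rightarrow> nat"
begin

definition point :: "('m + 'n) set \<times> nat \<Rightarrow> ('m, 'n) input" where
  "point x = (\<chi> i. coord (Inl i) x, \<chi> j. coord (Inr j) x)"

lemma message_in_dirichlet: "(\<lambda>x. message_value q (point x)) \<in> dirichlet"
  by (cases q)
     (auto simp: point_def coord_in_dirichlet intro!: subalgebra_poly_eval[OF subalgebra_dirichlet])

text \<open>Induction along the path of the positive points, with \<open>qs\<close> holding the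
  messages of the ancestors as functions of \<open>(S, k)\<close>. The set \<open>S\<close> is
  chosen only at the leaf, when all messages are known, and remains undetected for every prefix of
  the list.\<close>

lemma protocol_fooled:
  assumes "well_formed (length qs) p" "set qs \<subseteq> dirichlet"
    and "length qs + depth p < CARD('m + 'n)"
  shows "\<exists>S. S \<noteq> {} \<and> undetected S qs \<and>
    (\<forall>\<^sub>F k in sequentially. accepts (map (\<lambda>q. q (S, k)) qs) p (point (S, k)) \<longleftrightarrow>
       accepts (map (\<lambda>q. q ({}, k)) qs) p (point ({}, k)))"
  using assms
proof (induction p arbitrary: qs)
  case (Leaf b)
  then show ?case using exists_undetected[of qs] by auto
next
  case (Vertex q Ps branch cs)
  define ws where "ws = qs @ [\<lambda>x. message_value q (point x)]"
  define test where "test P x = poly_eval P (\<lambda>i. (ws ! i) x)" for P x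
  have ws: "set ws \<subseteq> dirichlet" using Vertex.prems(2) message_in_dirichlet by (simp add: ws_def)
  have vars: "i < length ws" if "P \<in> set Ps" "i \<in> poly_vars P" for P i
  proof -
    have "poly_vars P \<subseteq> {..length qs}" using Vertex.prems(1) that by simp
    then show ?thesis using that by (auto simp: ws_def)
  qed
  have test: "test P \<in> gen_algebra ws" if "P \<in> set Ps" for P
    unfolding test_def using vars[OF that]
    by (intro subalgebra_poly_eval subalgebra_gen_algebra nth_in_gen_algebra)
  have "\<exists>s. \<forall>\<^sub>F k in sequentially. sgn (test P ({}, k)) = s" if "P \<in> set Ps" for P
    using sgn_eventually_const test[OF that] gen_algebra_subset[OF subalgebra_dirichlet ws] by blast
  then obtain s where s: "\<And>P. P \<in> set Ps \<Longrightarrow> \<forall>\<^sub>F k in sequentially. sgn (test P ({}, k)) = s P"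
    by metis
  have s_sign: "s P \<in> {-1, 0, 1}" if P: "P \<in> set Ps" for P
  proof -
    obtain k where "sgn (test P ({}, k)) = s P"
      using eventually_happens'[OF _ s[OF P]] by auto
    then show ?thesis by (auto simp: sgn_if split: if_splits)
  qed
  \<comment> \<open>The child that the positive points enter for all large \<open>k\<close>.\<close>
  define c where "c = cs ! branch (map s Ps)"
  have br: "branch (map s Ps) < length cs"
  proof -
    have "set (map s Ps) \<subseteq> {-1, 0, 1}" using s_sign by auto
    then show ?thesis using Vertex.prems(1) by (auto simp del: set_map)
  qed
  then have c: "c \<in> set cs" by (simp add: c_def)
  \<comment> \<open>One more message against one level less of depth keeps the bound intact.\<close>
  have "depth c \<le> Max (insert 0 (depth ` set cs))" using c by (intro Max_ge) auto
  then have "length ws + depth c < CARD('m + 'n)"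
    using Vertex.prems(3) by (simp add: ws_def)
  moreover have "well_formed (length ws) c" using Vertex.prems(1) c by (simp add: ws_def)
  ultimately obtain S where S: "S \<noteq> {}" "undetected S ws"
    and acc: "\<forall>\<^sub>F k in sequentially. accepts (map (\<lambda>q. q (S, k)) ws) c (point (S, k)) \<longleftrightarrow>
       accepts (map (\<lambda>q. q ({}, k)) ws) c (point ({}, k))"
    using Vertex.IH[OF c, of ws] ws by blast
  have step: "accepts (map (\<lambda>q. q x) qs) (Vertex q Ps branch cs) (point x) \<longleftrightarrow>
      accepts (map (\<lambda>q. q x) ws) c (point x)" if x: "\<forall>P\<in>set Ps. sgn (test P x) = s P" for x
  proof -
    have "sgn (poly_eval P (\<lambda>i. (map (\<lambda>q. q x) ws) ! i)) = s P" if P: "P \<in> set Ps" for P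
    proof -
      have "poly_eval P (\<lambda>i. (map (\<lambda>q. q x) ws) ! i) = test P x"
        unfolding test_def poly_eval_def
      proof (intro sum.cong prod.cong refl arg_cong2[where f = "(*)"] arg_cong2[where f = power])
        fix m i assume "m \<in> Poly_Mapping.keys P" "i \<in> Poly_Mapping.keys m"
        then have "i < length ws" using vars[OF P] by (auto simp: poly_vars_def)
        then show "map (\<lambda>q. q x) ws ! i = (ws ! i) x" by simp
      qed
      then show ?thesis using x P by simp
    qed
    then have "map (\<lambda>P. sgn (poly_eval P (\<lambda>i. (map (\<lambda>q. q x) ws) ! i))) Ps = map s Ps"
      by simp
    moreover have "map (\<lambda>q. q x) qs @ [message_value q (point x)] = map (\<lambda>q. q x) ws"
      by (simp add: ws_def)
    ultimately show ?thesis using br by (simp only: accepts.simps Let_def c_def nth_map)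
  qed
  have "\<forall>\<^sub>F k in sequentially. \<forall>P\<in>set Ps. sgn (test P ({}, k)) = s P"
    using s by (intro eventually_ball_finite) auto
  \<comment> \<open>Undetectability shows the same signs at the flipped points, so both inputs enter
    \<open>c\<close>.\<close>
  moreover have "\<forall>\<^sub>F k in sequentially. \<forall>P\<in>set Ps. sgn (test P (S, k)) = sgn (test P ({}, k))"
    using S(2) test by (intro eventually_ball_finite) (auto simp: undetected_def)
  ultimately have "\<forall>\<^sub>F k in sequentially.
      accepts (map (\<lambda>q. q (S, k)) qs) (Vertex q Ps branch cs) (point (S, k)) \<longleftrightarrow>
      accepts (map (\<lambda>q. q ({}, k)) qs) (Vertex q Ps branch cs) (point ({}, k))"
    using acc by eventually_elim (use step in simp)
  then show ?case using S undetected_appendD unfolding ws_def by blast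
qed

section \<open>The depth bound\<close>

lemma coord_pos: "coord u ({}, k) > 0"
  using prime_gt_0_nat[OF prime_label] by (simp add: coord_def)

lemma coord_neg: "u \<in> S \<Longrightarrow> coord u (S, k) < 0"
  using prime_gt_0_nat[OF prime_label] by (simp add: coord_def)

text \<open>Positive points lie in \<open>U\<close> and points with a negative coordinate do not,
  yet a shallow protocol answers alike on two such points. Placing \<open>U\<close> between the open
  and the closed orthant covers an open orthant and its closure at once.\<close>

lemma depth_lower_bound:
  fixes p :: "('m, 'n) protocol"
  assumes wf: "well_formed 0 p" and rec: "recognizes p U"
    and pos: "{(x, y). (\<forall>i. x $ i > 0) \<and> (\<forall>j. y $ j > 0)} \<subseteq> U"
    and nonneg: "U \<subseteq> {(x, y). (\<forall>i. x $ i \<ge> 0) \<and> (\<forall>j. y $ j \<ge> 0)}"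
  shows "CARD('m) + CARD('n) \<le> depth p"
proof (rule ccontr)
  assume "\<not> ?thesis"
  then obtain S where S: "S \<noteq> {}"
    and "\<forall>\<^sub>F k in sequentially. accepts [] p (point (S, k)) \<longleftrightarrow> accepts [] p (point ({}, k))"
    using protocol_fooled[of "[]" p] wf by (auto simp: card_UNIV_sum)
  then obtain k where k: "accepts [] p (point (S, k)) \<longleftrightarrow> accepts [] p (point ({}, k))"
    using eventually_happens by force
  have "point ({}, k) \<in> U" using pos coord_pos by (auto simp: point_def)
  then have "point (S, k) \<in> U" using k rec unfolding recognizes_def by blast
  then have "coord u (S, k) \<ge> 0" for u
    using nonneg by (cases u) (auto simp: point_def)
  then show False using S coord_neg by (meson ex_in_conv not_le)
qed

end

lemma exists_input_labelling: "\<exists>\<pi> :: 'm::finite + 'n::finite \<Rightarrow> nat. input_labelling \<pi>"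
proof -
  obtain B where B: "B \<subseteq> {p::nat. prime p}" "finite B" "card B = CARD('m + 'n)"
    using infinite_arbitrarily_large[OF primes_infinite] by metis
  then obtain \<pi> where "bij_betw \<pi> (UNIV :: ('m + 'n) set) B"
    using finite_same_card_bij[of "UNIV :: ('m + 'n) set" B] by auto
  then have "inj \<pi>" "\<And>u. prime (\<pi> u)" using B(1) by (auto simp: bij_betw_def)
  then show ?thesis
    by (auto intro!: exI[of _ \<pi>] simp: input_labelling_def prime_labelling_def)
qed

lemma comm_complexity_lower_bound:
  fixes U :: "('m::finite, 'n::finite) input set"
  assumes "{(x, y). (\<forall>i. x $ i > 0) \<and> (\<forall>j. y $ j > 0)} \<subseteq> U"
    and "U \<subseteq> {(x, y). (\<forall>i. x $ i \<ge> 0) \<and> (\<forall>j. y $ j \<ge> 0)}"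
  shows "comm_complexity U \<ge> enat (CARD('m) + CARD('n))"
proof -
  obtain \<pi> :: "'m + 'n \<Rightarrow> nat" where "input_labelling \<pi>" using exists_input_labelling by blast
  then interpret input_labelling \<pi> .
  show ?thesis unfolding comm_complexity_def
    by (rule INF_greatest) (use depth_lower_bound assms in auto)
qed

theorem theorem1:
  fixes T :: "('m::finite, 'n::finite) input set"
  assumes "T = {(x, y). (\<forall>i. x $ i > 0) \<and> (\<forall>j. y $ j > 0)}"
  shows "comm_complexity T \<ge> enat (CARD('m) + CARD('n)) \<and>
         comm_complexity (closure T) \<ge> enat (CARD('m) + CARD('n))"
proof
  let ?N = "{(x, y). (\<forall>i. x $ i \<ge> 0) \<and> (\<forall>j. y $ j \<ge> 0)} :: ('m, 'n) input set"
  have TN: "T \<subseteq> ?N" by (auto simp: assms less_imp_le)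
  show "comm_complexity T \<ge> enat (CARD('m) + CARD('n))"
    using TN assms by (intro comm_complexity_lower_bound) auto
  have "closed ?N"
    by (auto simp: case_prod_beta' intro!: closed_Collect_conj closed_Collect_all closed_Collect_le
        continuous_intros)
  then have "closure T \<subseteq> ?N" using TN by (rule closure_minimal[rotated])
  then show "comm_complexity (closure T) \<ge> enat (CARD('m) + CARD('n))"
    using closure_subset[of T] unfolding assms by (intro comm_complexity_lower_bound)
qed

end
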